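(* Let $\Gamma$ be a pure simplicial complex of dimension $d$ in $\mathbb R^d$ with vertices in a finite set $\mathcal A\subset\mathbb R^d$ with $n$ elements. If there exists a real $d\times n$ matrix $C$ such that the pair $(\Gamma,C)$ is a positively decorated simplicial complex, then the dual graph of $\Gamma$ is bipartite.
   Context: Simplicial complexes are finite geometric simplicial complexes embedded in $\mathbb R^d$; pure of dimension $d$ means that all maximal simplices have dimension $d$. A real $d\times(d+1)$ matrix $M$ is oriented if the values $(-1)^i\operatorname{minor}(M,i)$, $i=1,\dots,d+1$, are all nonzero and have the same sign, where $\operatorname{minor}(M,i)$ is the determinant of the matrix obtained by removing the $i$-th column of $M$. The columns of $C$ are indexed by the points of $\mathcal A$ (in a fixed order), and $(\Gamma,C)$ is a positively decorated simplicial complex if for every $d$-simplex of $\Gamma$ the $d\times(d+1)$ submatrix of $C$ whose columns correspond to the vertices of this simplex is oriented. The dual graph of $\Gamma$ has the $d$-simplices of $\Gamma$ as vertices, two being adjacent when they share a common facet. *)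

theory Defs
  imports "HOL-Analysis.Analysis" "Jordan_Normal_Form.Determinant"
    "Jordan_Normal_Form.DL_Submatrix"
begin

text \<open>
  Geometric simplicial complexes in \<open>\<real>\<^sup>d\<close> are the library's \<^const>\<open>simplicial_complex\<close>
  (a finite set of simplices closed under taking faces, any two meeting in a common face)
  on the type \<open>real ^ 'd\<close>, with \<open>d = CARD('d)\<close>.  The \<open>d \<times> (d+1)\<close> and \<open>d \<times> n\<close> matrices
  are dimension-carrying matrices of type \<open>real mat\<close>, whose rows and columns are numbered from 0.
\<close>

definition simplex_vertices :: "(real ^ 'd) set \<Rightarrow> (real ^ 'd) set" where
  "simplex_vertices \<sigma> = {v. v extreme_point_of \<sigma>}"

definition maximal_simplex :: "(real ^ 'd) set set \<Rightarrow> (real ^ 'd) set \<Rightarrow> bool" where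
  "maximal_simplex \<Gamma> \<sigma> \<longleftrightarrow> \<sigma> \<in> \<Gamma> \<and> (\<forall>\<tau>\<in>\<Gamma>. \<sigma> \<subseteq> \<tau> \<longrightarrow> \<tau> = \<sigma>)"

definition pure_simplicial_complex :: "nat \<Rightarrow> (real ^ 'd) set set \<Rightarrow> bool" where
  "pure_simplicial_complex k \<Gamma> \<longleftrightarrow>
     simplicial_complex \<Gamma> \<and> (\<forall>\<sigma>. maximal_simplex \<Gamma> \<sigma> \<longrightarrow> int k simplex \<sigma>)"

definition simplices_of_dim :: "nat \<Rightarrow> (real ^ 'd) set set \<Rightarrow> (real ^ 'd) set set" where
  "simplices_of_dim k \<Gamma> = {\<sigma>\<in>\<Gamma>. int k simplex \<sigma>}"

text \<open>The index \<open>i\<close> is 1-based here: the column removed is the one numbered \<open>i - 1\<close>.\<close>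

definition col_minor :: "real mat \<Rightarrow> nat \<Rightarrow> real" where
  "col_minor M i = Determinant.det (submatrix M UNIV (- {i - 1}))"

definition oriented :: "real mat \<Rightarrow> bool" where
  "oriented M \<longleftrightarrow> dim_col M = dim_row M + 1 \<and>
     ((\<forall>i\<in>{1..dim_row M + 1}. (-1) ^ i * col_minor M i > 0) \<or>
      (\<forall>i\<in>{1..dim_row M + 1}. (-1) ^ i * col_minor M i < 0))"

text \<open>The function \<open>a\<close> enumerates the points that index the columns: column \<open>j\<close> of \<open>C\<close> belongs to \<open>a j\<close>.\<close>

definition vertex_columns ::
    "(nat \<Rightarrow> real ^ 'd) \<Rightarrow> real mat \<Rightarrow> (real ^ 'd) set \<Rightarrow> real mat" where
  "vertex_columns a C \<sigma> = submatrix C UNIV {j. a j \<in> simplex_vertices \<sigma>}"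

definition positively_decorated ::
    "(nat \<Rightarrow> real ^ 'd) \<Rightarrow> (real ^ 'd) set set \<Rightarrow> real mat \<Rightarrow> bool" where
  "positively_decorated a \<Gamma> C \<longleftrightarrow> simplicial_complex \<Gamma> \<and>
     (\<forall>\<sigma> \<in> simplices_of_dim CARD('d) \<Gamma>. oriented (vertex_columns a C \<sigma>))"

text \<open>A simple graph is the pair of its vertex set and its set of edges (two-element vertex sets).\<close>

definition dual_graph ::
    "(real ^ 'd) set set \<Rightarrow> (real ^ 'd) set set \<times> (real ^ 'd) set set set" where
  "dual_graph \<Gamma> = (simplices_of_dim CARD('d) \<Gamma>,
     {{\<sigma>, \<tau>} | \<sigma> \<tau>. \<sigma> \<in> simplices_of_dim CARD('d) \<Gamma> \<and> \<tau> \<in> simplices_of_dim CARD('d) \<Gamma> \<and>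
        \<sigma> \<noteq> \<tau> \<and> (\<exists>F. F facet_of \<sigma> \<and> F facet_of \<tau>)})"

definition bipartite :: "'v set \<times> 'v set set \<Rightarrow> bool" where
  "bipartite G \<longleftrightarrow> (\<exists>X Y. X \<union> Y = fst G \<and> X \<inter> Y = {} \<and>
     (\<forall>e \<in> snd G. \<exists>x\<in>X. \<exists>y\<in>Y. e = {x, y}))"

end

theory Submission
  imports Defs
begin

text \<open>
  Let \<open>c v\<close> be the column of \<open>C\<close> that belongs to the point \<open>v\<close>.  On each \<open>d\<close>-simplex \<open>\<sigma>\<close> there is
  an affine map \<open>x \<mapsto> B\<^sub>\<sigma> x + e\<^sub>\<sigma>\<close> that sends every vertex \<open>v\<close> of \<open>\<sigma>\<close> to \<open>c v\<close>.  The signed maximal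
  minors of a \<open>d \<times> (d + 1)\<close> matrix of full rank span its kernel, so orientedness of the columns of
  \<open>\<sigma>\<close> says that the points \<open>c v\<close> span a \<open>d\<close>-simplex with the origin in its interior
  (\<open>oriented_imp_origin_inside_simplex\<close>).  Hence \<open>B\<^sub>\<sigma>\<close> is invertible and the affine map vanishes at
  a point in the interior of \<open>\<sigma>\<close>.  The two colour classes are given by the sign of \<open>det B\<^sub>\<sigma>\<close>.

  Let \<open>\<sigma>\<close> and \<open>\<tau>\<close> share a facet.  They lie on different sides of a hyperplane \<open>h \<bullet> x = b\<close> that
  contains this facet (\<open>neighbouring_simplices_separated\<close>).  The two affine maps agree on the
  hyperplane, so \<open>B\<^sub>\<tau> = B\<^sub>\<sigma> + u h\<^sup>T\<close> for some vector \<open>u\<close>, that is, \<open>B\<^sub>\<tau> = B\<^sub>\<sigma> (1 + w h\<^sup>T)\<close> with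
  \<open>B\<^sub>\<sigma> w = u\<close>, and \<open>det B\<^sub>\<tau> = (1 + h \<bullet> w) det B\<^sub>\<sigma>\<close>.  If \<open>x\<close> and \<open>y\<close> are the zeros of the two maps
  in the interiors of \<open>\<sigma>\<close> and \<open>\<tau>\<close>, then the factor \<open>1 + h \<bullet> w\<close> is the quotient
  \<open>(h \<bullet> x - b) / (h \<bullet> y - b)\<close>, which is negative because \<open>x\<close> and \<open>y\<close> lie strictly on different
  sides (\<open>det_sign_change_across_hyperplane\<close>).  So adjacent simplices have different colours.
\<close>

section \<open>Oriented matrices and simplices around the origin\<close>

(* From here on, \<open>$\<close> only selects the components of vectors in \<open>real ^ 'd\<close>. *)
no_notation vec_index (infixl \<open>$\<close> 100)

lemma submatrix_delete_column:
  assumes j: "j < dim_col M"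
  shows "submatrix M UNIV (- {j}) =
    Matrix.mat (dim_row M) (dim_col M - 1) (\<lambda>(i, k). M $$ (i, if k < j then k else Suc k))"
proof -
  have pick: "pick (- {j}) k = (if k < j then k else Suc k)" for k
  proof -
    let ?i = "if k < j then k else Suc k"
    have "{x \<in> - {j}. x < ?i} = (if k < j then {..<k} else {..k} - {j})"
      by auto
    then have "card {x \<in> - {j}. x < ?i} = k"
      by auto
    moreover have "?i \<in> - {j}"
      by auto
    ultimately show ?thesis
      using pick_card_in_set[of ?i "- {j}"] by simp
  qed
  have cols: "card {k. k < dim_col M \<and> k \<in> - {j}} = dim_col M - 1"
  proof -
    have "{k. k < dim_col M \<and> k \<in> - {j}} = {..<dim_col M} - {j}"
      by auto
    then show ?thesis
      using j by simp
  qed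
  show ?thesis
    unfolding submatrix_def cols by (simp add: pick pick_UNIV)
qed

text \<open>
  The signed maximal minors form a kernel vector: each row of \<open>M\<close> times this vector is the Laplace
  expansion of a determinant in which that row occurs twice.  Orientedness makes all its entries
  positive, up to a common sign.
\<close>

lemma oriented_positive_kernel_vector:
  assumes "oriented M"
  obtains l where "\<And>k. k < dim_col M \<Longrightarrow> l k > 0"
    and "\<And>r. r < dim_row M \<Longrightarrow> (\<Sum>k<dim_col M. M $$ (r, k) * l k) = 0"
proof -
  define d where "d = dim_row M"
  have dc: "dim_col M = Suc d"
    using assms by (simp add: oriented_def d_def)
  let ?m = "\<lambda>k. (- 1) ^ Suc k * col_minor M (Suc k)"
  have "\<exists>s::real. \<forall>k<Suc d. s * ?m k > 0"
  proof -
    consider "\<forall>i\<in>{1..d + 1}. (- 1) ^ i * col_minor M i > 0"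
      | "\<forall>i\<in>{1..d + 1}. (- 1) ^ i * col_minor M i < 0"
      using assms by (auto simp: oriented_def d_def)
    then show ?thesis
    proof cases
      case 1
      then have "\<forall>k<Suc d. 1 * ?m k > 0"
        by (metis Suc_eq_plus1 Suc_leI atLeastAtMost_iff le_add2 mult_1)
      then show ?thesis by blast
    next
      case 2
      have "?m k < 0" if "k < Suc d" for k
        using 2 that by (metis Suc_eq_plus1 Suc_leI atLeastAtMost_iff le_add2)
      then have "\<forall>k<Suc d. (- 1) * ?m k > 0"
        by (metis mult_minus1 neg_0_less_iff_less)
      then show ?thesis by blast
    qed
  qed
  then obtain s :: real where s: "\<And>k. k < Suc d \<Longrightarrow> s * ?m k > 0"
    by blast
  have "(\<Sum>k<Suc d. M $$ (r, k) * (s * ?m k)) = 0" if r: "r < d" for r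
  proof -
    \<comment> \<open>\<open>A\<close> is \<open>M\<close> with a second copy of its row \<open>r\<close> put on top.\<close>
    define A where "A = Matrix.mat (Suc d) (Suc d)
      (\<lambda>(i, j). if i = 0 then M $$ (r, j) else M $$ (i - 1, j))"
    have A: "A \<in> carrier_mat (Suc d) (Suc d)"
      by (simp add: A_def)
    have "Determinant.det A = 0"
    proof (rule det_identical_rows[OF A, of 0 "Suc r"])
      show "Matrix.row A 0 = Matrix.row A (Suc r)"
        using r by (intro eq_vecI) (auto simp: A_def)
    qed (use r in auto)
    moreover have "cofactor A 0 k = (- 1) ^ k * col_minor M (Suc k)" if "k < Suc d" for k
    proof -
      have "mat_delete A 0 k = submatrix M UNIV (- {k})"
        using that dc by (intro eq_matI)
          (auto simp: submatrix_delete_column mat_delete_def A_def d_def)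
      then show ?thesis
        by (simp add: cofactor_def col_minor_def)
    qed
    ultimately have "0 = (\<Sum>k<Suc d. M $$ (r, k) * ((- 1) ^ k * col_minor M (Suc k)))"
      using laplace_expansion_row[OF A, of 0] by (simp add: A_def)
    also have "\<dots> * (- s) = (\<Sum>k<Suc d. M $$ (r, k) * (s * ?m k))"
      unfolding sum_distrib_right by (intro sum.cong) auto
    finally show ?thesis by simp
  qed
  with s dc that[of "\<lambda>k. s * ?m k"] show thesis
    unfolding d_def by simp
qed

text \<open>
  Every kernel vector is a multiple of the positive one: subtracting the multiple with the same
  first entry leaves a kernel vector supported on the remaining columns, and these form an
  invertible matrix.  A multiple of a positive vector has sum 0 only if it vanishes.
\<close>

lemma oriented_columns_affine_independent:
  assumes ori: "oriented M"
    and ker: "\<And>r. r < dim_row M \<Longrightarrow> (\<Sum>k<dim_col M. M $$ (r, k) * m k) = 0"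
    and sum0: "(\<Sum>k<dim_col M. m k) = 0"
    and k: "k < dim_col M"
  shows "m k = 0"
proof -
  define d where "d = dim_row M"
  have dc: "dim_col M = Suc d"
    using ori by (simp add: oriented_def d_def)
  obtain l where l: "\<And>k. k < dim_col M \<Longrightarrow> l k > 0"
    and lker: "\<And>r. r < dim_row M \<Longrightarrow> (\<Sum>k<dim_col M. M $$ (r, k) * l k) = 0"
    using oriented_positive_kernel_vector[OF ori] by metis
  define t where "t = m 0 / l 0"
  define m' where "m' k = m k - t * l k" for k
  have m'0: "m' 0 = 0"
    using l[of 0] dc by (simp add: m'_def t_def)
  define N where "N = submatrix M UNIV (- {0})"
  have N: "N = Matrix.mat d d (\<lambda>(i, k). M $$ (i, Suc k))"
    using dc by (simp add: N_def submatrix_delete_column d_def)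
  have "col_minor M 1 \<noteq> 0"
    using ori by (force simp: oriented_def)
  then have "Determinant.det N \<noteq> 0"
    by (simp add: col_minor_def N_def)
  moreover have "N \<in> carrier_mat d d"
    by (simp add: N)
  moreover have "N *\<^sub>v Matrix.vec d (\<lambda>k. m' (Suc k)) = 0\<^sub>v d"
  proof (rule eq_vecI)
    fix r assume "r < dim_vec (0\<^sub>v d :: real Matrix.vec)"
    then have r: "r < d" by simp
    have "(\<Sum>k<Suc d. M $$ (r, k) * m' k)
        = (\<Sum>k<Suc d. M $$ (r, k) * m k) - t * (\<Sum>k<Suc d. M $$ (r, k) * l k)"
      unfolding m'_def sum_distrib_left sum_subtractf[symmetric]
      by (intro sum.cong) (auto simp: algebra_simps)
    also have "\<dots> = 0"
      using ker[of r] lker[of r] r dc by (simp add: d_def)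
    finally have "(\<Sum>k<d. M $$ (r, Suc k) * m' (Suc k)) = 0"
      by (simp add: sum.lessThan_Suc_shift m'0 del: sum.lessThan_Suc)
    then show "vec_index (N *\<^sub>v Matrix.vec d (\<lambda>k. m' (Suc k))) r = vec_index (0\<^sub>v d) r"
      using r by (simp add: N scalar_prod_def atLeast0LessThan)
  qed (simp add: N)
  ultimately have "Matrix.vec d (\<lambda>k. m' (Suc k)) = 0\<^sub>v d"
    using det_0_iff_vec_prod_zero_field[of N d] by (metis vec_carrier)
  then have "m' (Suc k) = 0" if "k < d" for k
    using that by (metis index_vec index_zero_vec(1))
  then have m: "m k = t * l k" if "k < Suc d" for k
    using that m'0 by (cases k) (auto simp: m'_def)
  have "t * (\<Sum>k<Suc d. l k) = 0"
    using sum0 m dc unfolding sum_distrib_left by simp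
  moreover have "(\<Sum>k<Suc d. l k) > 0"
    using l dc by (intro sum_pos) auto
  ultimately have "t = 0"
    by simp
  with m k dc show ?thesis
    by simp
qed

text \<open>
  For nonempty \<open>V\<close>, the first conjunct puts the origin into the relative interior of the convex
  hull of the points \<open>c v\<close> (the coefficients are not normalised), and the second one is affine
  independence of the family \<open>c\<close> on \<open>V\<close>.
\<close>

definition origin_inside_simplex :: "'a set \<Rightarrow> ('a \<Rightarrow> 'b :: real_vector) \<Rightarrow> bool" where
  "origin_inside_simplex V c \<longleftrightarrow>
     (\<exists>l. (\<forall>v\<in>V. l v > 0) \<and> (\<Sum>v\<in>V. l v *\<^sub>R c v) = 0) \<and>
     (\<forall>m. (\<Sum>v\<in>V. m v *\<^sub>R c v) = 0 \<and> sum m V = 0 \<longrightarrow> (\<forall>v\<in>V. m v = 0))"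

text \<open>
  The passage from matrices with numbered columns to vectors indexed by points.  The bijection \<open>f\<close>
  numbers the coordinates; the columns of the submatrix correspond to the points of \<open>V\<close> through
  \<open>a \<circ> pick J\<close>, so that linear relations between the columns are linear relations between the
  points.
\<close>

lemma oriented_imp_origin_inside_simplex:
  fixes C :: "real mat" and f :: "'d::finite \<Rightarrow> nat"
  assumes C: "C \<in> carrier_mat CARD('d) n"
    and a: "bij_betw a {0..<n} A" and V: "V \<subseteq> A"
    and f: "bij_betw f UNIV {..<CARD('d)}"
    and ori: "oriented (submatrix C UNIV {j. a j \<in> V})"
  shows "origin_inside_simplex V
    (\<lambda>v. (\<chi> i. C $$ (f i, the_inv_into {0..<n} a v)) :: real ^ 'd)"
proof -
  define J where "J = {j. a j \<in> V}"
  define M where "M = submatrix C UNIV J"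
  define N where "N = dim_col M"
  define c where "c = (\<lambda>v. (\<chi> i. C $$ (f i, the_inv_into {0..<n} a v)) :: real ^ 'd)"
  \<comment> \<open>\<open>a\<close> is arbitrary from \<open>n\<close> on, so \<open>J\<close> may contain indices that are not columns of \<open>C\<close>.\<close>
  define J' where "J' = {j. j < n \<and> j \<in> J}"
  have N: "N = card J'"
    using C by (simp add: N_def M_def dim_submatrix J'_def)
  have dr: "dim_row M = CARD('d)"
    using C by (simp add: M_def dim_submatrix)
  have fJ': "finite J'"
    by (simp add: J'_def)
  have pick_in: "pick J k \<in> J'" if "k < N" for k
    using that pick_reduce_set[of k n J] pick_in_set[of k J'] by (auto simp: N J'_def)
  have pick_inj: "inj_on (pick J) {..<N}"
  proof (rule inj_onI)
    fix x y assume "x \<in> {..<N}" "y \<in> {..<N}" "pick J x = pick J y"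
    then have "pick J' x = pick J' y" "x < card J'" "y < card J'"
      using pick_reduce_set[of x n J] pick_reduce_set[of y n J] by (auto simp: N J'_def)
    then show "x = y"
      by (metis linorder_neqE_nat pick_mono_le less_irrefl)
  qed
  have pick: "bij_betw (pick J) {..<N} J'"
    unfolding bij_betw_def
  proof
    show "pick J ` {..<N} = J'"
      using fJ' pick_in pick_inj
      by (intro card_subset_eq) (auto simp: card_image N)
  qed (fact pick_inj)
  have "bij_betw a J' V"
  proof -
    have "a ` J' = V"
    proof
      show "V \<subseteq> a ` J'"
      proof
        fix v assume "v \<in> V"
        moreover from this obtain j where "j \<in> {0..<n}" "v = a j"
          using a V by (auto simp: bij_betw_def)
        ultimately show "v \<in> a ` J'"
          by (auto simp: J'_def J_def)
      qed
    qed (auto simp: J'_def J_def)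
    moreover have "inj_on a J'"
      using a by (auto simp: bij_betw_def J'_def intro: inj_on_subset)
    ultimately show ?thesis
      by (simp add: bij_betw_def)
  qed
  define \<phi> where "\<phi> = a \<circ> pick J"
  have \<phi>: "bij_betw \<phi> {..<N} V"
    unfolding \<phi>_def using pick \<open>bij_betw a J' V\<close> by (rule bij_betw_trans)
  have entry: "c (\<phi> k) $ i = M $$ (f i, k)" if "k < N" for k i
  proof -
    have "pick J k \<in> {0..<n}"
      using pick_in[OF that] by (auto simp: J'_def)
    then have "the_inv_into {0..<n} a (\<phi> k) = pick J k"
      using a by (simp add: \<phi>_def bij_betw_def the_inv_into_f_f)
    moreover have "M $$ (f i, k) = C $$ (f i, pick J k)"
    proof -
      have "f i < CARD('d)"
        using f by (auto simp: bij_betw_def)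
      then show ?thesis
        using that C by (simp add: M_def submatrix_index N J'_def pick_UNIV)
    qed
    ultimately show ?thesis
      by (simp add: c_def)
  qed
  have relation: "(\<Sum>v\<in>V. m v *\<^sub>R c v) = 0 \<longleftrightarrow>
      (\<forall>r<dim_row M. (\<Sum>k<N. M $$ (r, k) * m (\<phi> k)) = 0)" for m
  proof -
    have comp: "(\<Sum>v\<in>V. m v *\<^sub>R c v) $ i = (\<Sum>k<N. M $$ (f i, k) * m (\<phi> k))" for i
    proof -
      have "(\<Sum>v\<in>V. m v *\<^sub>R c v) $ i = (\<Sum>v\<in>V. m v * c v $ i)"
        by simp
      also have "\<dots> = (\<Sum>k<N. m (\<phi> k) * c (\<phi> k) $ i)"
        by (rule sum.reindex_bij_betw[OF \<phi>, symmetric])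
      finally show ?thesis
        by (simp add: entry mult.commute)
    qed
    have "{..<dim_row M} = range f"
      using f dr by (simp add: bij_betw_def)
    then have "(\<forall>r<dim_row M. P r) \<longleftrightarrow> (\<forall>i. P (f i))" for P
      by (metis lessThan_iff rangeE rangeI)
    moreover have "(\<Sum>v\<in>V. m v *\<^sub>R c v) = 0 \<longleftrightarrow> (\<forall>i. (\<Sum>v\<in>V. m v *\<^sub>R c v) $ i = 0)"
      by (simp only: Finite_Cartesian_Product.vec_eq_iff zero_index)
    ultimately show ?thesis
      unfolding comp by simp
  qed
  have ori': "oriented M"
    using ori by (simp add: M_def J_def)
  have "\<exists>l. (\<forall>v\<in>V. l v > 0) \<and> (\<Sum>v\<in>V. l v *\<^sub>R c v) = 0"
  proof -
    obtain l where l: "\<And>k. k < N \<Longrightarrow> l k > 0"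
      "\<And>r. r < dim_row M \<Longrightarrow> (\<Sum>k<N. M $$ (r, k) * l k) = 0"
      using oriented_positive_kernel_vector[OF ori'] unfolding N_def by metis
    define l' where "l' = l \<circ> the_inv_into {..<N} \<phi>"
    have l': "l' (\<phi> k) = l k" if "k < N" for k
      using \<phi> that by (simp add: l'_def bij_betw_def the_inv_into_f_f)
    have "l' v > 0" if "v \<in> V" for v
      using \<phi> that l(1) l' by (auto simp: bij_betw_def)
    moreover have "(\<Sum>v\<in>V. l' v *\<^sub>R c v) = 0"
      unfolding relation using l(2) l' by simp
    ultimately show ?thesis
      by blast
  qed
  moreover have "\<forall>v\<in>V. m v = 0" if "(\<Sum>v\<in>V. m v *\<^sub>R c v) = 0" "sum m V = 0" for m
  proof -
    have "(\<Sum>k<N. m (\<phi> k)) = 0"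
      using sum.reindex_bij_betw[OF \<phi>, of m] that(2) by simp
    then have "m (\<phi> k) = 0" if "k < N" for k
      using oriented_columns_affine_independent[OF ori', of "\<lambda>k. m (\<phi> k)"] relation[of m]
        \<open>(\<Sum>v\<in>V. m v *\<^sub>R c v) = 0\<close> that by (simp add: N_def)
    then show ?thesis
      using \<phi> by (auto simp: bij_betw_def)
  qed
  ultimately show ?thesis
    unfolding origin_inside_simplex_def c_def by blast
qed

section \<open>Determinants under rank-one changes\<close>

text \<open>
  Conjugation by an invertible map \<open>E\<close> whose \<open>k\<close>-th component is \<open>h \<bullet> x\<close> replaces \<open>h\<close> by a basis
  vector.  The resulting matrix differs from the identity only in column \<open>k\<close>, and Cramer's rule
  gives its determinant.
\<close>

lemma det_identity_plus_rank_one: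
  fixes h w :: "real ^ 'n"
  shows "Determinants.det (matrix (\<lambda>x. x + inner h x *\<^sub>R w)) = 1 + inner h w"
proof (cases "h = 0")
  case True
  then show ?thesis
    by (simp add: matrix_id_mat_1 flip: id_def)
next
  case False
  then obtain k where k: "h $ k \<noteq> 0"
    by (auto simp: Finite_Cartesian_Product.vec_eq_iff)
  define g where "g = (\<lambda>x. x + inner h x *\<^sub>R w)"
  define E :: "real ^ 'n \<Rightarrow> real ^ 'n" where "E x = (\<chi> i. if i = k then inner h x else x $ i)" for x
  define K :: "real ^ 'n \<Rightarrow> real ^ 'n" where "K y = y + (y $ k) *\<^sub>R E w" for y
  have lin: "linear g" "linear E" "linear K"
    by (auto intro!: linearI simp: g_def E_def K_def Finite_Cartesian_Product.vec_eq_iff inner_simps algebra_simps)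
  have "inj E"
    unfolding linear_injective_0[OF lin(2)]
  proof (intro allI impI)
    fix x assume "E x = 0"
    then have 0: "(if i = k then inner h x else x $ i) = 0" for i
      by (simp add: E_def Finite_Cartesian_Product.vec_eq_iff)
    then have "x $ i = 0" if "i \<noteq> k" for i
      using that by metis
    then have "inner h x = h $ k * x $ k"
      by (simp add: inner_vec_def sum.remove[of UNIV k])
    with 0 k have "x $ k = 0"
      by (metis mult_eq_0_iff)
    with \<open>\<And>i. i \<noteq> k \<Longrightarrow> x $ i = 0\<close> show "x = 0"
      by (metis Finite_Cartesian_Product.vec_eq_iff zero_index)
  qed
  then have E0: "Determinants.det (matrix E) \<noteq> 0"
    using lin(2) det_nz_iff_inj by blast
  have "E \<circ> g = K \<circ> E"
    by (auto simp: fun_eq_iff E_def g_def K_def Finite_Cartesian_Product.vec_eq_iff inner_simps)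
  then have "matrix E ** matrix g = matrix K ** matrix E"
    using lin by (metis matrix_compose)
  then have "Determinants.det (matrix E) * Determinants.det (matrix g)
      = Determinants.det (matrix K) * Determinants.det (matrix E)"
    by (metis det_mul)
  then have "Determinants.det (matrix g) = Determinants.det (matrix K)"
    using E0 by simp
  also have "matrix K = (\<chi> i j. if j = k then (axis k 1 + E w) $ i else Finite_Cartesian_Product.mat 1 $ i $ j)"
    by (auto simp: matrix_def K_def Finite_Cartesian_Product.vec_eq_iff axis_def Finite_Cartesian_Product.mat_def)
  also have "Determinants.det \<dots> = 1 + inner h w"
    unfolding cramer_lemma[of k "Finite_Cartesian_Product.mat 1" "axis k 1 + E w", unfolded matrix_vector_mul_lid]
    by (simp add: E_def)
  finally show ?thesis
    by (simp add: g_def)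
qed

text \<open>
  Subtracting the two equations \<open>B x + e = 0\<close> and \<open>B' y + e' = 0\<close> shows that
  \<open>w = (x - y) / (h \<bullet> y - b)\<close> satisfies \<open>B w = u\<close>.  So \<open>B'\<close> is \<open>B\<close> composed with
  \<open>z \<mapsto> z + (h \<bullet> z) w\<close>, whose determinant \<open>1 + h \<bullet> w\<close> equals \<open>(h \<bullet> x - b) / (h \<bullet> y - b)\<close>.
\<close>

lemma det_sign_change_across_hyperplane:
  fixes B B' :: "real ^ 'n \<Rightarrow> real ^ 'n"
  assumes lin: "linear B" and B0: "Determinants.det (matrix B) \<noteq> 0"
    and B': "\<And>z. B' z = B z + inner h z *\<^sub>R u" and e': "e' = e - b *\<^sub>R u"
    and x: "B x + e = 0" "inner h x < b" and y: "B' y + e' = 0" "inner h y > b"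
  shows "Determinants.det (matrix B) * Determinants.det (matrix B') < 0"
proof -
  define s where "s = inner h y - b"
  have s: "s > 0"
    using y by (simp add: s_def)
  define w where "w = (x - y) /\<^sub>R s"
  have "B y + s *\<^sub>R u = B x"
  proof -
    have "B y + s *\<^sub>R u = (B' y + e') - e"
      by (simp add: B' e' s_def algebra_simps)
    also have "\<dots> = B x"
      using x(1) y(1) by (simp add: neg_eq_iff_add_eq_0 add.commute)
    finally show ?thesis .
  qed
  then have "s *\<^sub>R u = B (x - y)"
    using linear_diff[OF lin, of x y] by (metis add_diff_cancel_left')
  then have Bw: "B w = u"
    using s lin by (simp add: w_def linear_cmul flip: \<open>s *\<^sub>R u = B (x - y)\<close>)
  define g where "g = (\<lambda>z. z + inner h z *\<^sub>R w)"
  have "linear g"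
    by (auto intro!: linearI simp: g_def inner_simps algebra_simps)
  moreover have "B' = B \<circ> g"
    using lin by (auto simp: g_def B' Bw linear_add linear_cmul)
  ultimately have "Determinants.det (matrix B') = Determinants.det (matrix B) * (1 + inner h w)"
    using lin det_identity_plus_rank_one[of h w] by (simp add: matrix_compose det_mul g_def)
  moreover have "1 + inner h w = (inner h x - b) / s"
    using s by (simp add: w_def inner_simps field_simps) (simp add: s_def)
  moreover have "(inner h x - b) / s < 0"
    using s x by (simp add: divide_neg_pos)
  moreover have "Determinants.det (matrix B) * Determinants.det (matrix B) > 0"
    using B0 by (metis not_real_square_gt_zero)
  ultimately show ?thesis
    by (metis mult.assoc mult_pos_neg)
qed

section \<open>Affine maps determined by the vertices of a simplex\<close>

lemma affine_interpolation:
  fixes c :: "'a::euclidean_space \<Rightarrow> 'b::real_vector"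
  assumes "\<not> affine_dependent S"
  obtains B e where "linear B" "\<And>v. v \<in> S \<Longrightarrow> B v + e = c v"
proof (cases "S = {}")
  case True
  then show thesis
    using that[of "\<lambda>_. 0"] module_hom_zero linear_zero by auto
next
  case False
  then obtain p where p: "p \<in> S" by blast
  then have "independent ((\<lambda>x. - p + x) ` (S - {p}))"
    using assms affine_dependent_iff_dependent[of p "S - {p}"] by (simp add: insert_absorb)
  from linear_independent_extend[OF this, of "\<lambda>x. c (p + x) - c p"]
  obtain B where B: "linear B" "\<forall>v\<in>S - {p}. B (- p + v) = c v - c p"
    by auto
  have "B v + (c p - B p) = c v" if "v \<in> S" for v
  proof (cases "v = p")
    case False
    then have "B v - B p = c v - c p"
      using B that linear_diff[OF B(1), of v p] by simp
    then show ?thesis by (simp add: algebra_simps)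
  qed simp
  with B(1) that show thesis by blast
qed

lemma linear_const_on_affine_hull:
  assumes "linear f" "\<And>v. v \<in> S \<Longrightarrow> f v = k" "x \<in> affine hull S"
  shows "f x = k"
proof -
  have "affine {x. f x = k}"
    by (auto simp: affine_def linear_add[OF assms(1)] linear_cmul[OF assms(1)] simp flip: scaleR_left_distrib)
  then have "affine hull S \<subseteq> {x. f x = k}"
    using assms(2) by (intro hull_minimal) auto
  then show ?thesis
    using assms(3) by auto
qed

text \<open>
  A kernel vector of \<open>B\<close> is a combination of \<open>V\<close> with coefficient sum 0; applying \<open>B\<close> to it gives
  a relation of the same kind between the points \<open>c v\<close>, and there is no nontrivial one.
\<close>

lemma det_affine_interpolation_nonzero:
  fixes B :: "real ^ 'n \<Rightarrow> real ^ 'n"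
  assumes V: "finite V" "affine hull V = UNIV" and c: "origin_inside_simplex V c"
    and B: "linear B" "\<And>v. v \<in> V \<Longrightarrow> B v + e = c v"
  shows "Determinants.det (matrix B) \<noteq> 0"
proof -
  have "z = 0" if "B z = 0" for z
  proof -
    have "z \<in> affine hull V" "0 \<in> affine hull V"
      by (simp_all add: V)
    then obtain s t where s: "sum s V = 1" "(\<Sum>v\<in>V. s v *\<^sub>R v) = z"
      and t: "sum t V = 1" "(\<Sum>v\<in>V. t v *\<^sub>R v) = 0"
      unfolding affine_hull_finite[OF V(1)] by blast
    define m where "m v = s v - t v" for v
    have m: "sum m V = 0" "(\<Sum>v\<in>V. m v *\<^sub>R v) = z"
      using s t by (simp_all add: m_def sum_subtractf scaleR_left_diff_distrib)
    have "(\<Sum>v\<in>V. m v *\<^sub>R c v) = (\<Sum>v\<in>V. m v *\<^sub>R B v + m v *\<^sub>R e)"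
      using B(2) by (intro sum.cong) (auto simp flip: scaleR_right_distrib)
    also have "\<dots> = B (\<Sum>v\<in>V. m v *\<^sub>R v) + sum m V *\<^sub>R e"
      by (simp add: sum.distrib linear_sum[OF B(1)] linear_cmul[OF B(1)] scaleR_sum_left)
    also have "\<dots> = 0"
      using m that by simp
    finally have "\<forall>v\<in>V. m v = 0"
      using c m(1) unfolding origin_inside_simplex_def by blast
    then have "(\<Sum>v\<in>V. m v *\<^sub>R v) = 0"
      by simp
    with m(2) show "z = 0"
      by simp
  qed
  then show ?thesis
    using det_nz_iff_inj[OF B(1)] linear_injective_0[OF B(1)] by simp
qed

text \<open>
  The zero is the convex combination of \<open>V\<close> with the normalised coefficients \<open>l\<close> that represent
  the origin.  The coefficient \<open>r\<close> of \<open>p\<close> is positive, so the last clause puts the zero strictly on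
  the side of \<open>p\<close> of every hyperplane that contains \<open>V - {p}\<close> and not \<open>p\<close>.
\<close>

lemma affine_interpolation_zero:
  fixes B :: "'a::euclidean_space \<Rightarrow> 'b::real_vector"
  assumes V: "finite V" "p \<in> V" and c: "origin_inside_simplex V c"
    and B: "linear B" "\<And>v. v \<in> V \<Longrightarrow> B v + e = c v"
  obtains x r where "B x + e = 0" "r > 0"
    "\<And>h b. (\<And>v. v \<in> V - {p} \<Longrightarrow> inner h v = b) \<Longrightarrow> inner h x - b = r * (inner h p - b)"
proof -
  obtain l where l: "\<forall>v\<in>V. l v > 0" "(\<Sum>v\<in>V. l v *\<^sub>R c v) = 0"
    using c unfolding origin_inside_simplex_def by blast
  define t where "t = sum l V"
  have t: "t > 0"
    unfolding t_def using l(1) V by (intro sum_pos) auto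
  define x where "x = (\<Sum>v\<in>V. l v *\<^sub>R v) /\<^sub>R t"
  show thesis
  proof (rule that[of x "l p / t"])
    have "t *\<^sub>R (B x + e) = B (\<Sum>v\<in>V. l v *\<^sub>R v) + t *\<^sub>R e"
      using t by (simp add: x_def linear_cmul[OF B(1)] scaleR_right_distrib)
    also have "\<dots> = (\<Sum>v\<in>V. l v *\<^sub>R (B v + e))"
      by (simp add: linear_sum[OF B(1)] linear_cmul[OF B(1)] sum.distrib scaleR_right_distrib
          t_def scaleR_sum_left)
    also have "\<dots> = 0"
      using l(2) B(2) by simp
    finally show "B x + e = 0"
      using t by simp
    show "l p / t > 0"
      using l V t by simp
    fix h b assume eq: "\<And>v. v \<in> V - {p} \<Longrightarrow> inner h v = b"
    have "t * inner h x = (\<Sum>v\<in>V. l v * inner h v)"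
      using t by (simp add: x_def inner_sum_right)
    moreover have "t * b = (\<Sum>v\<in>V. l v * b)"
      by (simp add: t_def sum_distrib_right)
    ultimately have "t * (inner h x - b) = (\<Sum>v\<in>V. l v * (inner h v - b))"
      by (simp add: right_diff_distrib sum_subtractf)
    also have "\<dots> = l p * (inner h p - b)"
      using V eq by (simp add: sum.remove[of V p])
    finally show "inner h x - b = l p / t * (inner h p - b)"
      using t by (simp add: field_simps)
  qed
qed

section \<open>Neighbouring simplices\<close>

text \<open>
  The interiors of the two simplices are disjoint, because the intersection of the simplices is a
  proper face of at least one of them.  Any hyperplane that separates the interiors contains the
  common facet, and it contains neither of the two remaining vertices, because a hyperplane does
  not contain \<open>d + 1\<close> affinely independent points.
\<close>

lemma neighbouring_simplices_separated:
  fixes S T :: "'a::euclidean_space set"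
  assumes cx: "simplicial_complex \<Gamma>" "convex hull S \<in> \<Gamma>" "convex hull T \<in> \<Gamma>"
    and S: "\<not> affine_dependent S" "card S = Suc DIM('a)"
    and T: "\<not> affine_dependent T" "card T = Suc DIM('a)"
    and ne: "convex hull S \<noteq> convex hull T" and pq: "S - {p} = T - {q}"
  obtains h b where "\<And>v. v \<in> S - {p} \<Longrightarrow> inner h v = b" "inner h p < b" "inner h q > b"
proof -
  have faces: "convex hull S \<inter> convex hull T face_of convex hull S"
    "convex hull S \<inter> convex hull T face_of convex hull T"
    using cx unfolding simplicial_complex_def by (auto, metis Int_commute)
  have "interior (convex hull S) \<inter> interior (convex hull T) = {}"
  proof (rule ccontr)
    assume "interior (convex hull S) \<inter> interior (convex hull T) \<noteq> {}"
    then have "convex hull S \<inter> convex hull T = convex hull S"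
      "convex hull S \<inter> convex hull T = convex hull T"
      using face_of_disjoint_interior[OF faces(1)] face_of_disjoint_interior[OF faces(2)]
        interior_subset[of "convex hull S"] interior_subset[of "convex hull T"] by blast+
    with ne show False by simp
  qed
  moreover have int: "interior (convex hull S) \<noteq> {}" "interior (convex hull T) \<noteq> {}"
    using S T by (simp_all add: interior_convex_hull_eq_empty)
  ultimately obtain h b where h: "h \<noteq> 0"
    and le: "\<forall>x\<in>interior (convex hull S). inner h x \<le> b"
    and ge: "\<forall>x\<in>interior (convex hull T). inner h x \<ge> b"
    using separating_hyperplane_sets[of "interior (convex hull S)" "interior (convex hull T)"]
    by (auto simp: convex_interior)
  have "closure (interior (convex hull S)) \<subseteq> {x. inner h x \<le> b}"
    using le by (intro closure_minimal) (auto simp: closed_halfspace_le)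
  then have leS: "inner h v \<le> b" if "v \<in> S" for v
    using that int(1) closure_subset[of "convex hull S"] hull_subset[of S convex]
    by (simp add: convex_closure_interior) blast
  have "closure (interior (convex hull T)) \<subseteq> {x. inner h x \<ge> b}"
    using ge by (intro closure_minimal) (auto simp: closed_halfspace_ge)
  then have geT: "inner h v \<ge> b" if "v \<in> T" for v
    using that int(2) closure_subset[of "convex hull T"] hull_subset[of T convex]
    by (simp add: convex_closure_interior) blast
  have eq: "inner h v = b" if "v \<in> S - {p}" for v
    using leS[of v] geT[of v] that pq by auto
  have off: "\<exists>v\<in>V. inner h v \<noteq> b" if "\<not> affine_dependent V" "card V = Suc DIM('a)" for V
  proof (rule ccontr)
    assume "\<not> (\<exists>v\<in>V. inner h v \<noteq> b)"
    then have "inner h x = b" for x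
      using linear_const_on_affine_hull[of "inner h" V b x] affine_independent_span_eq[OF that]
      by (simp add: bounded_linear.linear bounded_linear_inner_right)
    from this[of 0] this[of h] h show False
      by simp
  qed
  have "inner h p < b"
    using off[OF S] eq leS by (metis Diff_iff order_less_le singletonD)
  moreover have "inner h q > b"
    using off[OF T] eq geT pq by (metis Diff_iff order_less_le singletonD)
  ultimately show thesis
    using eq that by blast
qed

text \<open>
  The two affine maps agree on the common facet, so \<open>B\<close> and \<open>B'\<close> differ by a rank-one map along
  the normal \<open>h\<close> of the separating hyperplane.
\<close>

lemma neighbouring_interpolations_opposite_sign:
  fixes S T :: "(real ^ 'n) set"
  assumes cx: "simplicial_complex \<Gamma>" "convex hull S \<in> \<Gamma>" "convex hull T \<in> \<Gamma>"
    and S: "\<not> affine_dependent S" "card S = Suc CARD('n)" "origin_inside_simplex S c"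
    and T: "\<not> affine_dependent T" "card T = Suc CARD('n)" "origin_inside_simplex T c"
    and ne: "convex hull S \<noteq> convex hull T"
    and pq: "p \<in> S" "q \<in> T" "S - {p} = T - {q}"
    and B: "linear B" "\<And>v. v \<in> S \<Longrightarrow> B v + e = c v"
    and B': "linear B'" "\<And>v. v \<in> T \<Longrightarrow> B' v + e' = c v"
  shows "Determinants.det (matrix B) * Determinants.det (matrix B') < 0"
proof -
  have fin: "finite S" "finite T"
    using S T by (simp_all add: aff_independent_finite)
  have hull: "affine hull S = UNIV"
    using affine_independent_span_eq[of S] S by simp
  obtain h b where h: "\<And>v. v \<in> S - {p} \<Longrightarrow> inner h v = b" "inner h p < b" "inner h q > b"
    using neighbouring_simplices_separated[OF cx S(1) _ T(1) _ ne pq(3)] S(2) T(2) by auto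
  obtain x r where x: "B x + e = 0" "r > 0" "inner h x - b = r * (inner h p - b)"
    using affine_interpolation_zero[OF fin(1) pq(1) S(3) B] h(1) by metis
  obtain y t where y: "B' y + e' = 0" "t > 0" "inner h y - b = t * (inner h q - b)"
    using affine_interpolation_zero[OF fin(2) pq(2) T(3) B'] h(1) pq(3) by metis
  have xb: "inner h x < b"
    using x h(2) by (metis diff_less_0_iff_less mult_pos_neg)
  have yb: "inner h y > b"
    using y h(3) by (metis diff_gt_0_iff_gt mult_pos_pos)
  \<comment> \<open>The difference of the two affine maps is \<open>z \<mapsto> (h \<bullet> z - b) u\<close>: both vanish on the common facet,
    and \<open>u\<close> makes them equal at \<open>p\<close>.\<close>
  define u where "u = (B' p + e' - c p) /\<^sub>R (inner h p - b)"
  define f where "f z = B' z - B z - inner h z *\<^sub>R u" for z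
  have "linear f"
    using B(1) B'(1)
    by (auto intro!: linearI simp: f_def inner_simps linear_add linear_cmul algebra_simps)
  have "f v = e - e' - b *\<^sub>R u" if "v \<in> S" for v
  proof -
    have "B' v + e' - c v = (inner h v - b) *\<^sub>R u"
    proof (cases "v = p")
      case True
      then show ?thesis using h(2) by (simp add: u_def)
    next
      case False
      then have "v \<in> S - {p}" using that by simp
      then have "inner h v = b" "v \<in> T"
        using h(1) pq(3) by blast+
      then show ?thesis using B'(2) by simp
    qed
    then show ?thesis
      using B(2)[OF that] by (simp add: f_def algebra_simps)
  qed
  then have f: "f z = e - e' - b *\<^sub>R u" for z
    using linear_const_on_affine_hull[OF \<open>linear f\<close>] hull by blast
  have "f 0 = 0"
    using \<open>linear f\<close> by (rule linear_0)
  with f have const: "e - e' - b *\<^sub>R u = 0"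
    by metis
  show ?thesis
  proof (rule det_sign_change_across_hyperplane[where h = h and b = b and u = u and e = e
        and e' = e' and x = x and y = y])
    show "Determinants.det (matrix B) \<noteq> 0"
      by (rule det_affine_interpolation_nonzero[OF fin(1) hull S(3) B])
    show "B' z = B z + inner h z *\<^sub>R u" for z
      using f[of z] const by (simp add: f_def algebra_simps)
    show "e' = e - b *\<^sub>R u"
      using const by (simp add: algebra_simps)
  qed (use B(1) x(1) xb y(1) yb in simp_all)
qed

section \<open>The dual graph\<close>

lemma simplex_vertices_simplex:
  assumes "int k simplex \<sigma>"
  shows "\<not> affine_dependent (simplex_vertices \<sigma>)" "card (simplex_vertices \<sigma>) = Suc k"
    "\<sigma> = convex hull (simplex_vertices \<sigma>)"
proof -
  obtain V where V: "\<not> affine_dependent V" "int (card V) = int k + 1" "\<sigma> = convex hull V"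
    using assms unfolding simplex_def by blast
  have "simplex_vertices \<sigma> = V"
    using V by (auto simp: simplex_vertices_def extreme_point_of_convex_hull_affine_independent)
  then show "\<not> affine_dependent (simplex_vertices \<sigma>)" "card (simplex_vertices \<sigma>) = Suc k"
    "\<sigma> = convex hull (simplex_vertices \<sigma>)"
    using V by simp_all
qed

lemma common_facet_opposite_vertices:
  assumes \<sigma>: "int k simplex \<sigma>" and \<tau>: "int k simplex \<tau>"
    and F: "F facet_of \<sigma>" "F facet_of \<tau>"
  obtains p q where "p \<in> simplex_vertices \<sigma>" "q \<in> simplex_vertices \<tau>"
    "simplex_vertices \<sigma> - {p} = simplex_vertices \<tau> - {q}"
proof -
  have "\<exists>p\<in>simplex_vertices \<rho>. simplex_vertices F = simplex_vertices \<rho> - {p}"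
    if \<rho>: "int k simplex \<rho>" "F facet_of \<rho>" for \<rho>
  proof -
    let ?V = "simplex_vertices \<rho>"
    have "F facet_of (convex hull ?V)"
      using \<rho>(2) by (subst (asm) simplex_vertices_simplex(3)[OF \<rho>(1)])
    then obtain p where p: "p \<in> ?V" "F = convex hull (?V - {p})"
      unfolding facet_of_convex_hull_affine_independent[OF simplex_vertices_simplex(1)[OF \<rho>(1)]]
      by blast
    have "\<not> affine_dependent (?V - {p})"
      using simplex_vertices_simplex(1)[OF \<rho>(1)] affine_dependent_subset by blast
    then have "simplex_vertices F = ?V - {p}"
      unfolding p(2) by (auto simp: simplex_vertices_def[of "convex hull _"]
          extreme_point_of_convex_hull_affine_independent)
    with p(1) show ?thesis by blast
  qed
  from this[OF \<sigma> F(1)] this[OF \<tau> F(2)] that show thesis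
    by metis
qed

theorem proposition3p4:
  fixes A :: "(real ^ 'd) set"
    and n :: nat
    and a :: "nat \<Rightarrow> real ^ 'd"
    and \<Gamma> :: "(real ^ 'd) set set"
  assumes "finite A" and "card A = n"
    and "bij_betw a {0..<n} A"
    and "pure_simplicial_complex CARD('d) \<Gamma>"
    and "\<forall>\<sigma>\<in>\<Gamma>. simplex_vertices \<sigma> \<subseteq> A"
    and "\<exists>C \<in> carrier_mat CARD('d) n. positively_decorated a \<Gamma> C"
  shows "bipartite (dual_graph \<Gamma>)"
proof -
  let ?D = "simplices_of_dim CARD('d) \<Gamma>"
  obtain C where C: "C \<in> carrier_mat CARD('d) n" and dec: "positively_decorated a \<Gamma> C"
    using assms(6) by blast
  have cx: "simplicial_complex \<Gamma>"
    using dec by (simp add: positively_decorated_def)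
  have D: "\<sigma> \<in> \<Gamma>" "int CARD('d) simplex \<sigma>" if "\<sigma> \<in> ?D" for \<sigma>
    using that by (simp_all add: simplices_of_dim_def)
  obtain f :: "'d \<Rightarrow> nat" where f: "bij_betw f UNIV {..<CARD('d)}"
    using ex_bij_betw_finite_nat[OF finite[of "UNIV :: 'd set"]] by (auto simp: atLeast0LessThan)
  define c :: "real ^ 'd \<Rightarrow> real ^ 'd"
    where "c v = (\<chi> i. C $$ (f i, the_inv_into {0..<n} a v))" for v
  have c: "origin_inside_simplex (simplex_vertices \<sigma>) c" if "\<sigma> \<in> ?D" for \<sigma>
    unfolding c_def
  proof (rule oriented_imp_origin_inside_simplex[OF C assms(3) _ f])
    show "simplex_vertices \<sigma> \<subseteq> A"
      using assms(5) D that by blast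
    show "oriented (submatrix C UNIV {j. a j \<in> simplex_vertices \<sigma>})"
      using dec that by (simp add: positively_decorated_def vertex_columns_def)
  qed
  have "\<exists>B e. linear B \<and> (\<forall>v\<in>simplex_vertices \<sigma>. B v + e = c v)" if "\<sigma> \<in> ?D" for \<sigma>
    using affine_interpolation[of "simplex_vertices \<sigma>" c] simplex_vertices_simplex(1) D(2) that
    by metis
  then obtain B e where B: "\<And>\<sigma>. \<sigma> \<in> ?D \<Longrightarrow> linear (B \<sigma>)"
    "\<And>\<sigma> v. \<sigma> \<in> ?D \<Longrightarrow> v \<in> simplex_vertices \<sigma> \<Longrightarrow> B \<sigma> v + e \<sigma> = c v"
    by metis
  define s where "s \<sigma> = Determinants.det (matrix (B \<sigma>))" for \<sigma>
  have opposite: "s \<sigma> * s \<tau> < 0"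
    if \<sigma>: "\<sigma> \<in> ?D" and \<tau>: "\<tau> \<in> ?D" and ne: "\<sigma> \<noteq> \<tau>" and F: "F facet_of \<sigma>" "F facet_of \<tau>" for \<sigma> \<tau> F
  proof -
    note V = simplex_vertices_simplex[OF D(2)[OF \<sigma>]] and W = simplex_vertices_simplex[OF D(2)[OF \<tau>]]
    obtain p q where "p \<in> simplex_vertices \<sigma>" "q \<in> simplex_vertices \<tau>"
      "simplex_vertices \<sigma> - {p} = simplex_vertices \<tau> - {q}"
      using common_facet_opposite_vertices[OF D(2)[OF \<sigma>] D(2)[OF \<tau>] F] .
    then show ?thesis
      unfolding s_def using D(1) \<sigma> \<tau> ne
      by (intro neighbouring_interpolations_opposite_sign[OF cx _ _ V(1,2) c[OF \<sigma>] W(1,2) c[OF \<tau>]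
            _ _ _ _ B(1)[OF \<sigma>] B(2)[OF \<sigma>] B(1)[OF \<tau>] B(2)[OF \<tau>]]) (simp_all flip: V(3) W(3))
  qed
  define X where "X = {\<sigma> \<in> ?D. s \<sigma> > 0}"
  define Y where "Y = {\<sigma> \<in> ?D. \<not> s \<sigma> > 0}"
  have "\<exists>x\<in>X. \<exists>y\<in>Y. E = {x, y}" if edge: "E \<in> snd (dual_graph \<Gamma>)" for E
  proof -
    obtain \<sigma> \<tau> F where E: "E = {\<sigma>, \<tau>}" "\<sigma> \<in> ?D" "\<tau> \<in> ?D" "\<sigma> \<noteq> \<tau>" "F facet_of \<sigma>" "F facet_of \<tau>"
      using edge unfolding dual_graph_def snd_conv mem_Collect_eq by blast
    then have "s \<sigma> * s \<tau> < 0"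
      using opposite by blast
    then have "\<sigma> \<in> X \<and> \<tau> \<in> Y \<or> \<tau> \<in> X \<and> \<sigma> \<in> Y"
      using E by (auto simp: X_def Y_def mult_less_0_iff)
    then show ?thesis
      using E(1) by (auto simp: insert_commute)
  qed
  moreover have "X \<union> Y = fst (dual_graph \<Gamma>)" "X \<inter> Y = {}"
    by (auto simp: X_def Y_def dual_graph_def)
  ultimately show ?thesis
    unfolding bipartite_def by blast
qed

end
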